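(* Let $S$ be a subspace of $\mathbb{C}^n$ and let $e_j$ be a member of the fixed orthonormal basis $E$ such that $P_Se_j\neq0$. Let $v^j=P_Se_j/\|P_Se_j\|$. Then $|v^j|^2=(|v^j_1|^2,\dots,|v^j_n|^2)$ is an extreme point of $m_S$. Moreover, if $|v^j|^2=t|y|^2+(1-t)|z|^2$ with $0<t<1$ and $y,z\in S$, $\|y\|=\|z\|=1$, then $y$ and $z$ must be (complex scalar) multiples of $v^j$.
   Context: $E=\{e_1,\dots,e_n\}$ is a fixed orthonormal basis of $\mathbb{C}^n$. For $x\in\mathbb{C}^n$, $x_i=\langle x,e_i\rangle$ and $|x|^2=(|x_1|^2,\dots,|x_n|^2)$. $P_S$ is the orthogonal projection onto $S$ and the moment of $S$ is $m_S=\operatorname{conv}\{|v|^2:v\in S,\ \|v\|=1\}\subset\mathbb{R}^n_{\ge0}$. *)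

theory Defs
  imports "HOL-Analysis.Analysis"
begin

text \<open>
  The type \<^typ>\<open>complex ^ 'n\<close> only carries a real inner product in the library, so the Hermitian
  one (linear in the first argument) is defined here; it induces the library norm.
  Complex subspaces, spans and scalar multiples are \<open>vec.subspace\<close>, \<open>vec.span\<close> and \<open>*s\<close>;
  the unqualified \<open>subspace\<close> and \<open>span\<close> are over the reals.
\<close>

definition herm :: "complex ^ 'n \<Rightarrow> complex ^ 'n \<Rightarrow> complex"
  where "herm x y = (\<Sum>i\<in>UNIV. x $ i * cnj (y $ i))"

lemma herm_self: "herm x x = complex_of_real ((norm x)\<^sup>2)"
  by (simp add: herm_def norm_vec_def L2_set_def sum_nonneg flip: complex_norm_square)

lemma Re_herm: "Re (herm x y) = x \<bullet> y"
  by (simp add: herm_def inner_vec_def inner_complex_def)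

definition orthonormal_basis :: "('n \<Rightarrow> complex ^ 'n) \<Rightarrow> bool"
  where "orthonormal_basis e \<longleftrightarrow>
    (\<forall>i j. herm (e i) (e j) = (if i = j then 1 else 0)) \<and> vec.span (range e) = UNIV"

definition abs_sq :: "('n \<Rightarrow> complex ^ 'n) \<Rightarrow> complex ^ 'n \<Rightarrow> real ^ 'n"
  where "abs_sq e x = (\<chi> i. (cmod (herm x (e i)))\<^sup>2)"

text \<open>Meaningful when \<open>S\<close> is a complex subspace; see \<open>orth_proj_ex1\<close> below.\<close>

definition orth_proj :: "(complex ^ 'n) set \<Rightarrow> complex ^ 'n \<Rightarrow> complex ^ 'n"
  where "orth_proj S x = (THE p. p \<in> S \<and> (\<forall>s\<in>S. herm (x - p) s = 0))"

lemma orth_proj_ex1: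
  fixes S :: "(complex ^ 'n) set"
  assumes "vec.subspace S"
  shows "\<exists>!p. p \<in> S \<and> (\<forall>s\<in>S. herm (x - p) s = 0)"
proof -
  have scale: "c *s s \<in> S" if "s \<in> S" for c s
    using assms that by (rule vec.subspace_scale)
  have real_scale: "r *\<^sub>R s = complex_of_real r *s s" for r and s :: "complex ^ 'n"
    by (simp add: vec_eq_iff complex_eq_iff del: scaleR_conv_of_real)
  have real_subspace: "subspace S"
    unfolding subspace_def real_scale
    using vec.subspace_0[OF assms] vec.subspace_add[OF assms] scale by blast
  obtain p z where p: "p \<in> span S" and z: "\<And>w. w \<in> span S \<Longrightarrow> orthogonal z w"
    and x: "x = p + z"
    using orthogonal_subspace_decomp_exists by metis
  have spanS: "span S = S"
    using real_subspace by (simp add: span_eq_iff)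
  have "herm (x - p) s = 0" if s: "s \<in> S" for s
  proof -
    have "Re (herm z s) = 0"
      using z s spanS by (simp add: Re_herm orthogonal_def)
    moreover have "Re (herm z (\<i> *s s)) = 0"
      using z scale[OF s] spanS by (simp add: Re_herm orthogonal_def)
    moreover have "herm z (\<i> *s s) = - \<i> * herm z s"
      by (simp add: herm_def sum_distrib_left algebra_simps sum_negf)
    ultimately show ?thesis
      by (simp add: x complex_eq_iff)
  qed
  moreover have "q = p" if q: "q \<in> S" "\<forall>s\<in>S. herm (x - q) s = 0"
    and p': "p \<in> S" "\<forall>s\<in>S. herm (x - p) s = 0" for p q
  proof -
    have d: "q - p \<in> S"
      using vec.subspace_diff[OF assms] q p' by blast
    have "herm (q - p) (q - p) = herm (x - p) (q - p) - herm (x - q) (q - p)"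
      by (simp add: herm_def sum_subtractf[symmetric] algebra_simps)
    with d q p' show ?thesis
      by (simp add: herm_self)
  qed
  ultimately show ?thesis
    using p spanS by (metis (no_types, lifting))
qed

definition moment :: "('n \<Rightarrow> complex ^ 'n) \<Rightarrow> (complex ^ 'n) set \<Rightarrow> (real ^ 'n) set"
  where "moment e S = convex hull {abs_sq e v |v. v \<in> S \<and> norm v = 1}"

end

theory Submission
  imports Defs
begin

text \<open>
  For \<open>y \<in> S\<close> the \<open>j\<close>-th coordinate of \<open>y\<close> is \<open>\<langle>y, P\<^sub>S e\<^sub>j\<rangle>\<close>. By Cauchy-Schwarz, among the unit
  vectors of \<open>S\<close> the linear functional \<open>x \<mapsto> x\<^sub>j\<close> on \<open>|y|\<^sup>2\<close> is therefore maximal exactly at the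
  multiples of \<open>v\<^sup>j\<close>, all of which have the same image \<open>|v\<^sup>j|\<^sup>2\<close>. Thus \<open>|v\<^sup>j|\<^sup>2\<close> is the unique
  maximizer of a linear functional on \<open>m\<^sub>S\<close>.
\<close>

lemma herm_diff_left: "herm (x - y) z = herm x z - herm y z"
  by (simp add: herm_def algebra_simps sum_subtractf)

lemma herm_scale_left: "herm (c *s x) z = c * herm x z"
  by (simp add: herm_def sum_distrib_left algebra_simps)

lemma cnj_herm: "cnj (herm x y) = herm y x"
  by (simp add: herm_def mult.commute)

lemma herm_diff_right: "herm z (x - y) = herm z x - herm z y"
  by (simp add: herm_def algebra_simps sum_subtractf)

lemma herm_scale_right: "herm z (c *s x) = cnj c * herm z x"
  by (simp add: herm_def sum_distrib_left algebra_simps)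

lemma scaleR_eq_vector_smult: "r *\<^sub>R (x :: complex ^ 'n) = complex_of_real r *s x"
  by (simp add: vec_eq_iff complex_eq_iff del: scaleR_conv_of_real)

text \<open>The residual \<open>x - orth_proj S x\<close> is orthogonal to \<open>S\<close>, so
  pairing with a vector of \<open>S\<close> cannot tell \<open>x\<close> from its
  projection.\<close>

lemma orth_proj_props:
  assumes "vec.subspace S"
  shows orth_proj_in: "orth_proj S x \<in> S"
    and herm_orth_proj: "s \<in> S \<Longrightarrow> herm s (orth_proj S x) = herm s x"
proof -
  have *: "orth_proj S x \<in> S \<and> (\<forall>s\<in>S. herm (x - orth_proj S x) s = 0)"
    unfolding orth_proj_def using orth_proj_ex1[OF assms] by (rule theI')
  then show "orth_proj S x \<in> S"
    by blast
  show "herm s (orth_proj S x) = herm s x" if "s \<in> S"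
  proof -
    \<comment> \<open>The residual sits in the first argument of \<open>herm\<close>; conjugation
      moves it to the second.\<close>
    have "cnj (herm (x - orth_proj S x) s) = 0"
      using * that by simp
    then show ?thesis
      by (simp add: cnj_herm herm_diff_right)
  qed
qed

text \<open>Pythagoras for the part of \<open>y\<close> orthogonal to \<open>v\<close>.
  Nonnegativity of the left side yields Cauchy-Schwarz, and its vanishing yields the equality
  case.\<close>

lemma norm_residual_unit:
  assumes "norm v = 1"
  shows "(norm (y - herm y v *s v))\<^sup>2 = (norm y)\<^sup>2 - (cmod (herm y v))\<^sup>2"
proof -
  have "complex_of_real ((norm (y - herm y v *s v))\<^sup>2)
      = herm y y - cnj (herm y v) * herm y v"
    using assms unfolding herm_self[symmetric]
    by (simp add: herm_diff_left herm_diff_right herm_scale_left herm_scale_right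
        herm_self[of v] cnj_herm)
  also have "\<dots> = complex_of_real ((norm y)\<^sup>2 - (cmod (herm y v))\<^sup>2)"
    by (simp add: herm_self mult.commute complex_norm_square del: of_real_power)
  finally show ?thesis
    using of_real_eq_iff by blast
qed

lemma herm_unit_le_1:
  assumes "norm v = 1" "norm y = 1"
  shows "(cmod (herm y v))\<^sup>2 \<le> 1"
  using norm_residual_unit[OF assms(1), of y] assms(2)
    zero_le_power2[of "norm (y - herm y v *s v)"]
  by simp

lemma herm_unit_eq_1_iff:
  assumes "norm v = 1" "norm y = 1"
  shows "(cmod (herm y v))\<^sup>2 = 1 \<longleftrightarrow> y = herm y v *s v"
proof -
  have "y = herm y v *s v \<longleftrightarrow> (norm (y - herm y v *s v))\<^sup>2 = 0"
    by simp
  then show ?thesis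
    unfolding norm_residual_unit[OF assms(1)] assms(2) by auto
qed

lemma abs_sq_scale: "abs_sq e (c *s x) = (cmod c)\<^sup>2 *\<^sub>R abs_sq e x"
  by (simp add: abs_sq_def vec_eq_iff herm_scale_left norm_mult power_mult_distrib)

text \<open>The gaps \<open>m - a\<close> and \<open>m - b\<close> are nonnegative and their sum
  with positive weights is zero, so both vanish.\<close>

lemma convex_combination_eq_upper_bound:
  fixes a b m t :: real
  assumes "0 < t" "t < 1" "a \<le> m" "b \<le> m" "t * a + (1 - t) * b = m"
  shows "a = m" "b = m"
proof -
  have "t * (m - a) + (1 - t) * (m - b) = 0"
    using assms(5) by (simp add: algebra_simps)
  moreover have "0 \<le> t * (m - a)" "0 \<le> (1 - t) * (m - b)"
    using assms by simp_all
  ultimately have "t * (m - a) = 0" "(1 - t) * (m - b) = 0"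
    by linarith+
  then show "a = m" "b = m"
    using assms by simp_all
qed

text \<open>An open half-space together with one point \<open>a\<close> of its boundary is convex.
  This set \<open>H\<close> contains \<open>X\<close>, hence also the hull, and \<open>a\<close> is
  already extreme in \<open>H\<close>.\<close>

lemma unique_maximizer_extreme_point:
  fixes f :: "'a::real_vector \<Rightarrow> real"
  assumes f: "linear f" and a: "a \<in> X" and max: "\<And>x. x \<in> X \<Longrightarrow> x \<noteq> a \<Longrightarrow> f x < f a"
  shows "a extreme_point_of (convex hull X)"
proof -
  interpret linear f by (rule f)
  define H where "H = insert a {x. f x < f a}"
  have H_le: "f x \<le> f a" if "x \<in> H" for x
    using that by (auto simp: H_def)
  have H_eq: "x = a" if "x \<in> H" "f x = f a" for x
    using that by (auto simp: H_def)
  \<comment> \<open>Serves twice: for the convexity of \<open>H\<close>, at combinations that reach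
    the height \<open>f a\<close>, and for the extremality of \<open>a\<close>.\<close>
  have both_eq: "x = a \<and> y = a"
    if "x \<in> H" "y \<in> H" "0 < u" "u < 1" "f ((1 - u) *\<^sub>R x + u *\<^sub>R y) = f a" for x y u
    using convex_combination_eq_upper_bound[of "1 - u" "f x" "f a" "f y"] that H_le H_eq
    by (simp add: add scale)
  have "convex H"
    unfolding convex_alt
  proof (intro ballI allI impI)
    fix x y u assume xy: "x \<in> H" "y \<in> H" and u: "0 \<le> (u::real) \<and> u \<le> 1"
    let ?w = "(1 - u) *\<^sub>R x + u *\<^sub>R y"
    show "?w \<in> H"
    proof (cases "0 < u \<and> u < 1")
      case True
      have "f ?w \<le> f a"
        using convex_bound_le[of "f x" "f a" "f y" "1 - u" u] H_le xy u
        by (simp add: add scale)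
      moreover have "?w = a" if "f ?w = f a"
        using both_eq[OF xy _ _ that] True by (simp flip: scaleR_add_left)
      ultimately show ?thesis
        by (auto simp: H_def)
    next
      case False
      with u have "u = 0 \<or> u = 1" by linarith
      with xy show ?thesis by auto
    qed
  qed
  moreover have "X \<subseteq> H"
    using max by (auto simp: H_def)
  ultimately have "convex hull X \<subseteq> H"
    by (rule hull_minimal[rotated])
  \<comment> \<open>An open segment through \<open>a\<close> would have both endpoints equal to
    \<open>a\<close>, but the endpoints of a nonempty open segment are distinct.\<close>
  moreover have "a \<notin> open_segment x y" if "x \<in> H" "y \<in> H" for x y
    using both_eq[OF that] unfolding in_segment by metis
  ultimately show ?thesis
    unfolding extreme_point_of_def using hull_inc[OF a, of convex] by blast
qed

theorem proposition4p4:
  fixes e :: "'n::finite \<Rightarrow> complex ^ 'n" and S :: "(complex ^ 'n) set"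
    and j :: 'n and v :: "complex ^ 'n"
  assumes "orthonormal_basis e"
    and "vec.subspace S"
    and "orth_proj S (e j) \<noteq> 0"
    and "v = orth_proj S (e j) /\<^sub>R norm (orth_proj S (e j))"
  shows "abs_sq e v extreme_point_of moment e S
    \<and> (\<forall>(t::real) y z.
          0 < t \<and> t < 1 \<and> y \<in> S \<and> z \<in> S \<and> norm y = 1 \<and> norm z = 1
          \<and> abs_sq e v = t *\<^sub>R abs_sq e y + (1 - t) *\<^sub>R abs_sq e z
        \<longrightarrow> (\<exists>c. y = c *s v) \<and> (\<exists>c. z = c *s v))"
proof -
  define p where "p = orth_proj S (e j)"
  note S = assms(2)
  have p0: "p \<noteq> 0" and v: "v = p /\<^sub>R norm p"
    using assms(3,4) by (simp_all add: p_def)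
  have norm_v: "norm v = 1"
    using p0 by (simp add: v)
  have v_S: "v \<in> S"
    unfolding v scaleR_eq_vector_smult p_def
    by (intro vec.subspace_scale[OF S] orth_proj_in[OF S])
  have p_v: "p = complex_of_real (norm p) *s v"
    using p0 by (simp add: v flip: scaleR_eq_vector_smult)
  \<comment> \<open>On \<open>S\<close>, pairing with \<open>e j\<close> is pairing with
    \<open>p\<close>, which is \<open>norm p\<close> times the unit vector \<open>v\<close>.\<close>
  have coord: "abs_sq e y $ j = (norm p)\<^sup>2 * (cmod (herm y v))\<^sup>2" if "y \<in> S" for y
  proof -
    have "herm y (e j) = herm y p"
      using herm_orth_proj[OF S that] by (simp add: p_def)
    also have "\<dots> = complex_of_real (norm p) * herm y v"
      by (subst p_v) (simp add: herm_scale_right)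
    finally show ?thesis
      by (simp add: abs_sq_def norm_mult power_mult_distrib)
  qed
  have coord_v: "abs_sq e v $ j = (norm p)\<^sup>2"
    using norm_v by (simp add: coord[OF v_S] herm_self)
  have coord_le: "abs_sq e y $ j \<le> abs_sq e v $ j" if "y \<in> S" "norm y = 1" for y
    using herm_unit_le_1[OF norm_v that(2)] mult_left_le[of _ "(norm p)\<^sup>2"]
    by (simp add: coord[OF that(1)] coord_v)
  have coord_eq: "y = herm y v *s v" "cmod (herm y v) = 1"
    if "y \<in> S" "norm y = 1" "abs_sq e y $ j = abs_sq e v $ j" for y
  proof -
    \<comment> \<open>Since \<open>p\<close> is nonzero, the common factor \<open>(norm p)^2\<close>
      cancels.\<close>
    have *: "(cmod (herm y v))\<^sup>2 = 1"
      using that(3) p0 by (simp add: coord[OF that(1)] coord_v)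
    then show "y = herm y v *s v"
      using herm_unit_eq_1_iff[OF norm_v that(2)] by blast
    show "cmod (herm y v) = 1"
      using * by (simp add: power2_eq_1_iff) (smt (verit) norm_ge_zero)
  qed
  have "abs_sq e v extreme_point_of moment e S"
    unfolding moment_def
  proof (rule unique_maximizer_extreme_point[where f = "\<lambda>x. x $ j"])
    show "linear (\<lambda>x::real ^ 'n. x $ j)"
      by (rule bounded_linear.linear[OF bounded_linear_vec_nth])
    show "abs_sq e v \<in> {abs_sq e v |v. v \<in> S \<and> norm v = 1}"
      using v_S norm_v by blast
    fix x assume "x \<in> {abs_sq e v |v. v \<in> S \<and> norm v = 1}" and ne: "x \<noteq> abs_sq e v"
    then obtain y where y: "y \<in> S" "norm y = 1" and x: "x = abs_sq e y"
      by blast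
    \<comment> \<open>Many vectors \<open>y\<close> attain the maximum, but they differ from
      \<open>v\<close> only by a scalar of modulus one, which \<open>abs_sq\<close> does not
      see.\<close>
    have "x = abs_sq e v" if "x $ j = abs_sq e v $ j"
    proof -
      have "y = herm y v *s v" "cmod (herm y v) = 1"
        using coord_eq[OF y] that x by blast+
      then show ?thesis
        unfolding x by (metis abs_sq_scale one_power2 scaleR_one)
    qed
    with ne coord_le[OF y] show "x $ j < abs_sq e v $ j"
      unfolding x by fastforce
  qed
  moreover have "(\<exists>c. y = c *s v) \<and> (\<exists>c. z = c *s v)"
    if t: "0 < t" "t < 1" and y: "y \<in> S" "norm y = 1" and z: "z \<in> S" "norm z = 1"
      and eq: "abs_sq e v = t *\<^sub>R abs_sq e y + (1 - t) *\<^sub>R abs_sq e z" for t y z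
  proof -
    \<comment> \<open>The \<open>j\<close>-th coordinate of the identity alone suffices: it forces
      \<open>y\<close> and \<open>z\<close> to attain the maximum as well.\<close>
    have "t * abs_sq e y $ j + (1 - t) * abs_sq e z $ j = abs_sq e v $ j"
      by (simp add: eq)
    note ends = convex_combination_eq_upper_bound[OF t coord_le[OF y] coord_le[OF z] this]
    show ?thesis
      using coord_eq(1)[OF y ends(1)] coord_eq(1)[OF z ends(2)] by blast
  qed
  ultimately show ?thesis
    by blast
qed

end
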